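(* Run the W-TQA procedure described in the context with step size $\gamma>0$, and let $\ell_t:=\mathbf 1\{Y_{N+1,t}\notin C_t(X_{N+1,t})\}$ and $S_T:=\sum_{t=1}^TR_t$. Then, almost surely, for every $T\ge1$ with $S_T\ge1$, \[ \left|\frac1{S_T}\sum_{t=1}^TR_t\ell_t-\alpha\right|\le\frac{\max\{\alpha,1-\alpha\}+\gamma}{S_T\gamma}. \] In particular, if $S_T\to\infty$ as $T\to\infty$, then $\frac1{S_T}\sum_{t=1}^TR_t\ell_t$ converges to $\alpha$.
   Context: All random quantities live on a common probability space $(\Omega,\mathcal A,\mathbb P)$. Panel stream. Fix integers $N\ge1$, $d\ge1$. For units $i=1,\dots,N+1$ and rounds $t=1,2,\dots$ there are random pairs $(X_{i,t},Y_{i,t})\in\mathbb R^d\times\mathbb R$; units $1,\dots,N$ are calibration units and unit $N+1$ is the target. No exchangeability is assumed. $R_t\in\{0,1\}$ is a random variable indicating whether $Y_{N+1,t}$ is revealed (after prediction); no stochastic model is imposed on $R_t$. By convention $R_0=0$. Score. $\hat s:\mathbb R^d\times\mathbb R\to\mathbb R$ is a fixed (nonrandom) measurable function, and $\hat s_{i,t}:=\hat s(X_{i,t},Y_{i,t})$. W-TQA procedure, with parameters $\alpha\in[0,1]$, bandwidth $h>0$, stepsize $\gamma>0$. Initialize $\alpha_0=\alpha$, $\widehat\mu_{k,0}=0$, and $w^{(1)}_{N+1,k}=1/(N+1)$ for $k=1,\dots,N+1$. At each round $t=1,2,\dots$: (1) If $R_{t-1}=1$, set $\alpha_t=\alpha_{t-1}+\gamma(\alpha-\ell_{t-1})$,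 where $\ell_{t-1}=\mathbf 1\{Y_{N+1,t-1}\notin C_{t-1}(X_{N+1,t-1})\}$; otherwise set $\alpha_t=\alpha_{t-1}$. (2) Let $\widetilde s_t=(\hat s_{1,t},\dots,\hat s_{N,t},+\infty)$ and $\hat q_t=\inf\{q\in[-\infty,+\infty]:\sum_{k=1}^{N+1}w^{(t)}_{N+1,k}\mathbf 1\{(\widetilde s_t)_k\le q\}\ge 1-\alpha_t\}$, with $\inf\emptyset=+\infty$. The prediction set is $C_t(X_{N+1,t})=\{y\in\mathbb R:\hat s(X_{N+1,t},y)\le\hat q_t\}$ (so $\alpha_t>1$ gives the empty set, $\alpha_t<0$ gives $\mathbb R$). (3) Set $\widehat\mu_{k,t}=\frac1t\sum_{s=1}^tX_{k,s}$ for $k\le N+1$, $a_{k,t}=\exp\{-\|\widehat\mu_{k,t}-\widehat\mu_{N+1,t}\|_2^2/(2h^2)\}$ for $k\le N$, $a_{N+1,t}=1$, and $w^{(t+1)}_{N+1,k}=a_{k,t}/\sum_{j=1}^{N+1}a_{j,t}$ for $k\le N+1$. *)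

theory Defs
  imports "HOL-Probability.Probability"
begin

text \<open>
  Units are the naturals \<open>1, \<dots>, N + 1\<close>, with \<open>N + 1\<close> the target, and rounds are
  \<open>1, 2, \<dots>\<close>. The arguments of the processes \<open>X\<close>, \<open>Y\<close> are unit, round, outcome.
\<close>

definition run_mean ::
  "(nat \<Rightarrow> nat \<Rightarrow> 'a \<Rightarrow> real ^ 'd) \<Rightarrow> nat \<Rightarrow> nat \<Rightarrow> 'a \<Rightarrow> real ^ 'd" where
  "run_mean X k t \<omega> = (1 / real t) *\<^sub>R (\<Sum>s = 1..t. X k s \<omega>)"

definition kernel ::
  "nat \<Rightarrow> real \<Rightarrow> (nat \<Rightarrow> nat \<Rightarrow> 'a \<Rightarrow> real ^ 'd) \<Rightarrow> nat \<Rightarrow> nat \<Rightarrow> 'a \<Rightarrow> real" where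
  "kernel N h X k t \<omega> =
     (if k = N + 1 then 1
      else exp (- (norm (run_mean X k t \<omega> - run_mean X (N + 1) t \<omega>))\<^sup>2 / (2 * h\<^sup>2)))"

text \<open>
  \<open>weight N h X t k\<close> is the weight of unit \<open>k\<close> used in round \<open>t\<close>; it is uniform in round 1 and
  computed from the covariates of rounds \<open>1, \<dots>, t - 1\<close> afterwards. The value at \<open>t = 0\<close> is
  irrelevant.
\<close>

definition weight ::
  "nat \<Rightarrow> real \<Rightarrow> (nat \<Rightarrow> nat \<Rightarrow> 'a \<Rightarrow> real ^ 'd) \<Rightarrow> nat \<Rightarrow> nat \<Rightarrow> 'a \<Rightarrow> real" where
  "weight N h X t k \<omega> =
     (if t \<le> 1 then 1 / (real N + 1)
      else kernel N h X k (t - 1) \<omega> / (\<Sum>j = 1..N + 1. kernel N h X j (t - 1) \<omega>))"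

definition aug_score ::
  "nat \<Rightarrow> ((real ^ 'd) \<times> real \<Rightarrow> real) \<Rightarrow> (nat \<Rightarrow> nat \<Rightarrow> 'a \<Rightarrow> real ^ 'd) \<Rightarrow>
   (nat \<Rightarrow> nat \<Rightarrow> 'a \<Rightarrow> real) \<Rightarrow> nat \<Rightarrow> nat \<Rightarrow> 'a \<Rightarrow> ereal" where
  "aug_score N s X Y t k \<omega> = (if k = N + 1 then \<infinity> else ereal (s (X k t \<omega>, Y k t \<omega>)))"

text \<open>
  In the next two definitions \<open>a\<close> is the current level, the number \<open>\<alpha>\<^sub>t\<close> of the procedure; it may
  lie outside the unit interval. In \<^typ>\<open>ereal\<close> the infimum of the empty set is \<open>\<infinity>\<close>.
\<close>

definition quantile ::
  "nat \<Rightarrow> ((real ^ 'd) \<times> real \<Rightarrow> real) \<Rightarrow> real \<Rightarrow> (nat \<Rightarrow> nat \<Rightarrow> 'a \<Rightarrow> real ^ 'd) \<Rightarrow>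
   (nat \<Rightarrow> nat \<Rightarrow> 'a \<Rightarrow> real) \<Rightarrow> real \<Rightarrow> nat \<Rightarrow> 'a \<Rightarrow> ereal" where
  "quantile N s h X Y a t \<omega> =
     Inf {q. (\<Sum>k = 1..N + 1. weight N h X t k \<omega> * of_bool (aug_score N s X Y t k \<omega> \<le> q)) \<ge> 1 - a}"

definition pred_set ::
  "nat \<Rightarrow> ((real ^ 'd) \<times> real \<Rightarrow> real) \<Rightarrow> real \<Rightarrow> (nat \<Rightarrow> nat \<Rightarrow> 'a \<Rightarrow> real ^ 'd) \<Rightarrow>
   (nat \<Rightarrow> nat \<Rightarrow> 'a \<Rightarrow> real) \<Rightarrow> real \<Rightarrow> nat \<Rightarrow> 'a \<Rightarrow> real set" where
  "pred_set N s h X Y a t \<omega> =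
     {y. ereal (s (X (N + 1) t \<omega>, y)) \<le> quantile N s h X Y a t \<omega>}"

text \<open>
  The adaptive level \<open>\<alpha>\<^sub>t\<close>. Round 0 carries no data; the step from 0 to 1 is only meaningful
  under the convention \<open>R\<^sub>0 = 0\<close>, in which case it leaves the level at \<open>\<alpha>\<close>.
\<close>

primrec level ::
  "nat \<Rightarrow> ((real ^ 'd) \<times> real \<Rightarrow> real) \<Rightarrow> real \<Rightarrow> real \<Rightarrow> real \<Rightarrow>
   (nat \<Rightarrow> nat \<Rightarrow> 'a \<Rightarrow> real ^ 'd) \<Rightarrow> (nat \<Rightarrow> nat \<Rightarrow> 'a \<Rightarrow> real) \<Rightarrow>
   (nat \<Rightarrow> 'a \<Rightarrow> real) \<Rightarrow> nat \<Rightarrow> 'a \<Rightarrow> real" where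
  "level N s \<alpha> h \<gamma> X Y R 0 \<omega> = \<alpha>"
| "level N s \<alpha> h \<gamma> X Y R (Suc t) \<omega> =
     (let a = level N s \<alpha> h \<gamma> X Y R t \<omega> in
      if R t \<omega> = 1
      then a + \<gamma> * (\<alpha> - of_bool (Y (N + 1) t \<omega> \<notin> pred_set N s h X Y a t \<omega>))
      else a)"

definition miscov ::
  "nat \<Rightarrow> ((real ^ 'd) \<times> real \<Rightarrow> real) \<Rightarrow> real \<Rightarrow> real \<Rightarrow> real \<Rightarrow>
   (nat \<Rightarrow> nat \<Rightarrow> 'a \<Rightarrow> real ^ 'd) \<Rightarrow> (nat \<Rightarrow> nat \<Rightarrow> 'a \<Rightarrow> real) \<Rightarrow>
   (nat \<Rightarrow> 'a \<Rightarrow> real) \<Rightarrow> nat \<Rightarrow> 'a \<Rightarrow> real" where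
  "miscov N s \<alpha> h \<gamma> X Y R t \<omega> =
     of_bool (Y (N + 1) t \<omega> \<notin> pred_set N s h X Y (level N s \<alpha> h \<gamma> X Y R t \<omega>) t \<omega>)"

definition num_revealed :: "(nat \<Rightarrow> 'a \<Rightarrow> real) \<Rightarrow> nat \<Rightarrow> 'a \<Rightarrow> real" where
  "num_revealed R T \<omega> = (\<Sum>t = 1..T. R t \<omega>)"

end

theory Submission
  imports Defs
begin

text \<open>
  Telescoping the recursion gives \<open>\<alpha>\<^bsub>T+1\<^esub> - \<alpha> = \<gamma> (\<alpha> S\<^sub>T - \<Sum>\<^bsub>t\<le>T\<^esub> R\<^sub>t \<ell>\<^sub>t)\<close>, so it is enough to
  confine the level to \<open>[-\<gamma>, 1 + \<gamma>]\<close>. A single step moves it by at most \<open>\<gamma>\<close>. Above 1 the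
  prediction set is empty, so a loss is incurred and the level does not rise; below 0 the
  prediction set is the whole line, so no loss is incurred and the level does not fall.
\<close>

lemma kernel_pos: "kernel N h X k t \<omega> > 0"
  by (simp add: kernel_def)

lemma weight_nonneg: "weight N h X t k \<omega> \<ge> 0"
  unfolding weight_def
  by (simp add: divide_nonneg_nonneg sum_nonneg less_imp_le[OF kernel_pos] del: sum.cl_ivl_Suc)

text \<open>Normalisation, in both branches of \<open>weight\<close>. After round 1 the division is
  genuine because every kernel value is strictly positive.\<close>

lemma sum_weight: "(\<Sum>k = 1..N + 1. weight N h X t k \<omega>) = 1"
proof (cases "t \<le> 1")
  case True
  then show ?thesis by (simp add: weight_def add.commute)
next
  case False
  have "(\<Sum>j = 1..N + 1. kernel N h X j (t - 1) \<omega>) > 0"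
    by (intro sum_pos kernel_pos) auto
  with False show ?thesis
    by (simp add: weight_def flip: sum_divide_distrib del: sum.cl_ivl_Suc)
qed

text \<open>The threshold 1 - a is negative, so every extended real q qualifies,
  \<open>-\<infinity>\<close> included. The infimum is then \<open>-\<infinity>\<close>, which lies
  below every real score.\<close>

lemma pred_set_empty:
  assumes "a > 1"
  shows "pred_set N s h X Y a t \<omega> = {}"
proof -
  have "1 - a \<le> (\<Sum>k = 1..N + 1. weight N h X t k \<omega> * of_bool (aug_score N s X Y t k \<omega> \<le> q))" for q
    by (rule order.trans[of _ 0])
      (use assms in \<open>auto intro!: sum_nonneg weight_nonneg simp del: sum.cl_ivl_Suc\<close>)
  then have "{q. 1 - a \<le> (\<Sum>k = 1..N + 1. weight N h X t k \<omega> * of_bool (aug_score N s X Y t k \<omega> \<le> q))} = UNIV"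
    by blast
  then have "quantile N s h X Y a t \<omega> = -\<infinity>"
    unfolding quantile_def by (simp only: Inf_UNIV bot_ereal_def)
  then show ?thesis by (simp add: pred_set_def)
qed

text \<open>The threshold 1 - a exceeds the total weight 1, so not even q =
  \<open>\<infinity>\<close> qualifies, and the infimum of the empty set is
  \<open>\<infinity>\<close>.\<close>

lemma pred_set_UNIV:
  assumes "a < 0"
  shows "pred_set N s h X Y a t \<omega> = UNIV"
proof -
  have "(\<Sum>k = 1..N + 1. weight N h X t k \<omega> * of_bool (aug_score N s X Y t k \<omega> \<le> q))
      \<le> (\<Sum>k = 1..N + 1. weight N h X t k \<omega>)" for q
    by (intro sum_mono mult_left_le weight_nonneg) auto
  then have "\<not> 1 - a \<le> (\<Sum>k = 1..N + 1. weight N h X t k \<omega> * of_bool (aug_score N s X Y t k \<omega> \<le> q))" for q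
    unfolding sum_weight not_le by (rule order.strict_trans1) (use assms in simp)
  then have "{q. 1 - a \<le> (\<Sum>k = 1..N + 1. weight N h X t k \<omega> * of_bool (aug_score N s X Y t k \<omega> \<le> q))} = {}"
    by blast
  then have "quantile N s h X Y a t \<omega> = \<infinity>"
    unfolding quantile_def by (simp only: Inf_empty top_ereal_def)
  then show ?thesis by (simp add: pred_set_def)
qed

lemma miscov_cases: "miscov N s \<alpha> h \<gamma> X Y R t \<omega> = 0 \<or> miscov N s \<alpha> h \<gamma> X Y R t \<omega> = 1"
  by (simp add: miscov_def)

text \<open>Since R takes only the values 0 and 1, it can serve as a factor in place of the case
  split. This form is what telescopes.\<close>

lemma level_Suc_eq:
  assumes "R t \<omega> \<in> {0, 1}"
  shows "level N s \<alpha> h \<gamma> X Y R (Suc t) \<omega> =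
    level N s \<alpha> h \<gamma> X Y R t \<omega> + \<gamma> * (R t \<omega> * (\<alpha> - miscov N s \<alpha> h \<gamma> X Y R t \<omega>))"
  using assms by (auto simp: miscov_def Let_def)

lemma level_bounds:
  assumes R: "\<And>t. R t \<omega> \<in> {0, 1}" and \<alpha>: "0 \<le> \<alpha>" "\<alpha> \<le> 1" and \<gamma>: "\<gamma> > 0"
  shows "level N s \<alpha> h \<gamma> X Y R t \<omega> \<in> {- \<gamma>..1 + \<gamma>}"
proof (induction t)
  case 0
  then show ?case using \<alpha> \<gamma> by simp
next
  case (Suc t)
  define a where "a = level N s \<alpha> h \<gamma> X Y R t \<omega>"
  define l where "l = miscov N s \<alpha> h \<gamma> X Y R t \<omega>"
  define u where "u = level N s \<alpha> h \<gamma> X Y R (Suc t) \<omega>"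
  have l: "l = 0 \<or> l = 1" unfolding l_def by (rule miscov_cases)
  have hi: "a \<le> 1 \<or> l = 1"
    by (cases "a \<le> 1") (simp_all add: a_def l_def miscov_def pred_set_empty)
  have lo: "0 \<le> a \<or> l = 0"
    by (cases "0 \<le> a") (simp_all add: a_def l_def miscov_def pred_set_UNIV)
  have bd: "- \<gamma> \<le> a" "a \<le> 1 + \<gamma>" using Suc.IH by (simp_all add: a_def)
  have "0 \<le> \<gamma> * \<alpha>" "\<gamma> * \<alpha> \<le> \<gamma>" using \<alpha> \<gamma> by (simp_all add: mult_left_le)
  \<comment> \<open>Either the level stays put, or it rises from some a \<le> 1 (by
    \<open>hi\<close>, as l = 0), or it moves down from some a \<ge> 0 (by \<open>lo\<close>, as l =
    1). Each move has size at most \<gamma>.\<close>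
  moreover have "u = a \<or> u = a + \<gamma> * \<alpha> \<and> l = 0 \<or> u = a + \<gamma> * \<alpha> - \<gamma> \<and> l = 1"
    using R[of t] l unfolding u_def a_def l_def level_Suc_eq[where R = R and \<omega> = \<omega>, OF R]
    by (auto simp: right_diff_distrib)
  ultimately have "- \<gamma> \<le> u \<and> u \<le> 1 + \<gamma>"
    using hi lo bd \<gamma> by (elim disjE conjE) linarith+
  then show ?case by (simp add: u_def del: level.simps)
qed

text \<open>Because \<open>R 0 \<omega> = 0\<close>, the step from 0 to 1 contributes nothing, so
  the sum may start at round 1.\<close>

lemma level_telescope:
  assumes R: "\<And>t. R t \<omega> \<in> {0, 1}" and R0: "R 0 \<omega> = 0"
  shows "level N s \<alpha> h \<gamma> X Y R (Suc T) \<omega> - \<alpha> =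
    \<gamma> * (\<alpha> * num_revealed R T \<omega> - (\<Sum>t = 1..T. R t \<omega> * miscov N s \<alpha> h \<gamma> X Y R t \<omega>))"
proof (induction T)
  case 0
  then show ?case using R0 by (simp add: num_revealed_def)
next
  case (Suc T)
  then show ?case
    unfolding level_Suc_eq[where R = R and \<omega> = \<omega> and t = "Suc T", OF R]
    by (simp add: num_revealed_def algebra_simps del: level.simps)
qed

text \<open>A statement about one fixed outcome. It asks only for a positive count, so that it
  serves both the finite-T bound and the limit.\<close>

lemma miscov_rate_bound:
  assumes R: "\<And>t. R t \<omega> \<in> {0, 1}" and R0: "R 0 \<omega> = 0"
    and \<alpha>: "0 \<le> \<alpha>" "\<alpha> \<le> 1" and \<gamma>: "\<gamma> > 0" and S: "num_revealed R T \<omega> > 0"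
  shows "\<bar>1 / num_revealed R T \<omega> * (\<Sum>t = 1..T. R t \<omega> * miscov N s \<alpha> h \<gamma> X Y R t \<omega>) - \<alpha>\<bar>
    \<le> (max \<alpha> (1 - \<alpha>) + \<gamma>) / (num_revealed R T \<omega> * \<gamma>)"
proof -
  define S where "S = num_revealed R T \<omega>"
  define L where "L = (\<Sum>t = 1..T. R t \<omega> * miscov N s \<alpha> h \<gamma> X Y R t \<omega>)"
  define u where "u = level N s \<alpha> h \<gamma> X Y R (Suc T) \<omega>"
  have "S > 0" using S by (simp add: S_def)
  have u: "u - \<alpha> = \<gamma> * (\<alpha> * S - L)"
    unfolding u_def S_def L_def by (rule level_telescope[where R = R and \<omega> = \<omega>, OF R R0])
  have "1 / S * L - \<alpha> = - (u - \<alpha>) / (S * \<gamma>)"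
    unfolding u using \<open>S > 0\<close> \<gamma> by (simp add: field_simps)
  then have "\<bar>1 / S * L - \<alpha>\<bar> = \<bar>u - \<alpha>\<bar> / (S * \<gamma>)"
    using \<open>S > 0\<close> \<gamma> by (simp add: abs_mult abs_minus_commute)
  \<comment> \<open>From u in [-\<gamma>, 1 + \<gamma>] it follows that u - \<alpha> lies between
    -(\<alpha> + \<gamma>) and (1 - \<alpha>) + \<gamma>, which is where the maximum comes
    from.\<close>
  also have "\<dots> \<le> (max \<alpha> (1 - \<alpha>) + \<gamma>) / (S * \<gamma>)"
    using level_bounds[where R = R and \<omega> = \<omega> and t = "Suc T", OF R \<alpha> \<gamma>, of N s h X Y]
      \<open>S > 0\<close> \<gamma>
    unfolding u_def[symmetric]
    by (intro divide_right_mono) auto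
  finally show ?thesis unfolding S_def L_def .
qed

theorem theorem5p4:
  fixes M :: "'a measure"
    and N :: nat
    and X :: "nat \<Rightarrow> nat \<Rightarrow> 'a \<Rightarrow> real ^ 'd"
    and Y :: "nat \<Rightarrow> nat \<Rightarrow> 'a \<Rightarrow> real"
    and R :: "nat \<Rightarrow> 'a \<Rightarrow> real"
    and s :: "(real ^ 'd) \<times> real \<Rightarrow> real"
    and \<alpha> h \<gamma> :: real
  assumes "prob_space M"
    and "N \<ge> 1"
    and "\<And>i t. i \<in> {1..N + 1} \<Longrightarrow> t \<ge> 1 \<Longrightarrow> X i t \<in> borel_measurable M"
    and "\<And>i t. i \<in> {1..N + 1} \<Longrightarrow> t \<ge> 1 \<Longrightarrow> Y i t \<in> borel_measurable M"
    and "\<And>t. t \<ge> 1 \<Longrightarrow> R t \<in> borel_measurable M"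
    and "\<And>t \<omega>. t \<ge> 1 \<Longrightarrow> \<omega> \<in> space M \<Longrightarrow> R t \<omega> \<in> {0, 1}"
    and "\<And>\<omega>. \<omega> \<in> space M \<Longrightarrow> R 0 \<omega> = 0"
    and "s \<in> borel_measurable borel"
    and "0 \<le> \<alpha>" and "\<alpha> \<le> 1"
    and "h > 0" and "\<gamma> > 0"
  shows "AE \<omega> in M.
    (\<forall>T\<ge>1. num_revealed R T \<omega> \<ge> 1 \<longrightarrow>
       \<bar>1 / num_revealed R T \<omega> * (\<Sum>t = 1..T. R t \<omega> * miscov N s \<alpha> h \<gamma> X Y R t \<omega>) - \<alpha>\<bar>
         \<le> (max \<alpha> (1 - \<alpha>) + \<gamma>) / (num_revealed R T \<omega> * \<gamma>)) \<and>
    (filterlim (\<lambda>T. num_revealed R T \<omega>) at_top sequentially \<longrightarrow>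
       (\<lambda>T. 1 / num_revealed R T \<omega> * (\<Sum>t = 1..T. R t \<omega> * miscov N s \<alpha> h \<gamma> X Y R t \<omega>))
         \<longlonglongrightarrow> \<alpha>)"
\<comment> \<open>The argument is pathwise: both claims are shown at every outcome of the
  space.\<close>
proof (rule AE_I2, intro conjI impI)
  fix \<omega> assume \<omega>: "\<omega> \<in> space M"
  have R: "R t \<omega> \<in> {0, 1}" for t
    using assms(6)[OF _ \<omega>, of t] assms(7)[OF \<omega>] by (cases "t = 0") auto
  note bound = miscov_rate_bound[where R = R and \<omega> = \<omega>,
    OF R assms(7)[OF \<omega>] \<open>0 \<le> \<alpha>\<close> \<open>\<alpha> \<le> 1\<close> \<open>\<gamma> > 0\<close>]
  show "\<forall>T\<ge>1. num_revealed R T \<omega> \<ge> 1 \<longrightarrow>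
       \<bar>1 / num_revealed R T \<omega> * (\<Sum>t = 1..T. R t \<omega> * miscov N s \<alpha> h \<gamma> X Y R t \<omega>) - \<alpha>\<bar>
         \<le> (max \<alpha> (1 - \<alpha>) + \<gamma>) / (num_revealed R T \<omega> * \<gamma>)"
    by (intro allI impI bound) linarith
  assume lim: "filterlim (\<lambda>T. num_revealed R T \<omega>) at_top sequentially"
  have "((\<lambda>T. (max \<alpha> (1 - \<alpha>) + \<gamma>) / (num_revealed R T \<omega> * \<gamma>)) \<longlongrightarrow> 0) sequentially"
    using \<open>\<gamma> > 0\<close>
    by (intro real_tendsto_divide_at_top[OF tendsto_const]
        filterlim_at_top_mult_tendsto_pos[OF tendsto_const] lim)
  \<comment> \<open>For small T the count may be 0 and the quotients take the default value 0, so
    the comparison with the null sequence is made only eventually.\<close>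
  moreover have "\<forall>\<^sub>F T in sequentially. num_revealed R T \<omega> > 0"
    using lim unfolding filterlim_at_top_dense by blast
  then have "\<forall>\<^sub>F T in sequentially.
      norm (1 / num_revealed R T \<omega> * (\<Sum>t = 1..T. R t \<omega> * miscov N s \<alpha> h \<gamma> X Y R t \<omega>) - \<alpha>)
        \<le> (max \<alpha> (1 - \<alpha>) + \<gamma>) / (num_revealed R T \<omega> * \<gamma>)"
    by eventually_elim (simp only: real_norm_def bound)
  ultimately show "(\<lambda>T. 1 / num_revealed R T \<omega> * (\<Sum>t = 1..T. R t \<omega> * miscov N s \<alpha> h \<gamma> X Y R t \<omega>))
      \<longlonglongrightarrow> \<alpha>"
    by (subst LIM_zero_iff[symmetric]) (rule Lim_null_comparison)
qed

end
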